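(* Let $J\ge 3$ and let $F\in\tilde{\mathfrak{F}}$ be a symmetric cdf. The models $(\text{adjacent},F,\text{complete})$, $(\text{adjacent},F,\text{proportional})$, $(\text{cumulative},F,\text{complete})$ and $(\text{cumulative},F,\text{proportional})$ are each invariant under the reverse permutation $\tilde\sigma$ of $\{1,\dots,J\}$, $\tilde\sigma(j)=J-j+1$.
   Context: Setting. Let $J\ge 3$ (number of categories), $p\ge 1$, and let $\mathcal{X}\subseteq\mathbb{R}^p$ be the nonempty set of values of the explanatory vector $x$. Let $\mathcal{M}=\{\pi\in\,]0,1[^{J-1} : \sum_{j=1}^{J-1}\pi_j<1\}$; for $\pi\in\mathcal{M}$ put $\pi_J=1-\sum_{j=1}^{J-1}\pi_j$ ($\pi_j$ is the probability of category $j$). Ratios. The adjacent ratio $r:\mathcal{M}\to\,]0,1[^{J-1}$ is $r_j(\pi)=\pi_j/(\pi_j+\pi_{j+1})$; the cumulative ratio is $r_j(\pi)=\pi_1+\dots+\pi_j$, for $j=1,\dots,J-1$. Each is injective on $\mathcal{M}$. Cdfs. $\tilde{\mathfrak{F}}$ is the set of continuous cumulative distribution functions $F$ on $\mathbb{R}$ that are strictly increasing on the open interval $I_F=\{w: 0<F(w)<1\}$ (so that $F$ maps $I_F$ bijectively onto $]0,1[$) and symmetric, i.e. $F(w)=1-F(-w)$ for all $w$. Design matrices. "Complete" refers to the $(J-1)\times(J-1)(1+p)$ matrix $Z_c(x)$ with $Z_c(x)\beta=(\alpha_j+x^t\delta_j)_{j=1,\dots,J-1}$ for $\beta=(\alpha_1,\dots,\alpha_{J-1},\delta_1^t,\dots,\delta_{J-1}^t)^t$,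 $\alpha_j\in\mathbb{R}$, $\delta_j\in\mathbb{R}^p$. "Proportional" refers to the $(J-1)\times(J-1+p)$ matrix $Z_p(x)$ with $Z_p(x)\beta=(\alpha_j+x^t\delta)_{j=1,\dots,J-1}$ for $\beta=(\alpha_1,\dots,\alpha_{J-1},\delta^t)^t$, $\delta\in\mathbb{R}^p$. Models. A model $(r,F,Z)$, with $Z$ having $q$ columns, has as parameter space the set of $\beta\in\mathbb{R}^q$ such that for all $x\in\mathcal{X}$, $\eta=Z(x)\beta$ satisfies $\eta\in I_F^{J-1}$ and $(F(\eta_1),\dots,F(\eta_{J-1}))\in r(\mathcal{M})$. For such $\beta$ and $x\in\mathcal{X}$, it defines the unique $\pi=\pi(x;\beta)\in\mathcal{M}$ with $r(\pi)=(F(\eta_1),\dots,F(\eta_{J-1}))^t$, $\eta=Z(x)\beta$. Permuted models. For a permutation $\sigma$ of $\{1,\dots,J\}$ and $\pi\in\mathcal{M}$, let $\pi_\sigma=(\pi_{\sigma(1)},\dots,\pi_{\sigma(J-1)})\in\mathcal{M}$. The permuted model $(r,F,Z)_\sigma$ has the same parameter space as $(r,F,Z)$ and defines $\pi=\pi(x;\beta)\in\mathcal{M}$ by $r(\pi_\sigma)=(F(\eta_1),\dots,F(\eta_{J-1}))^t$, $\eta=Z(x)\beta$. Equivalence and invariance. Two (possibly permuted) models, giving $\pi(x;\beta)$ and $\pi'(x;\beta')$, are equivalent if there is a bijection $h$ from the parameter space of the first to that of the second such that $\pi(x;\beta)=\pi'(x;h(\beta))$ for all $x\in\mathcal{X}$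 and all $\beta$ in the first parameter space. A model $(r,F,Z)$ is invariant under $\sigma$ if $(r,F,Z)$ and $(r,F,Z)_\sigma$ are equivalent. *)

theory Defs
  imports
    "HOL-Probability.Distribution_Functions"
    "Jordan_Normal_Form.Matrix"
begin

unbundle no vec_syntax and no inner_syntax

type_synonym rvec = "real Matrix.vec"
type_synonym rmat = "real Matrix.mat"

(* Categories are numbered 1..J, vectors are indexed from 0: category j < J is entry j - 1. *)

definition prob_simplex :: "nat \<Rightarrow> rvec set" where
  "prob_simplex J =
     {\<pi> \<in> carrier_vec (J - 1). (\<forall>i<J - 1. 0 < \<pi> $ i \<and> \<pi> $ i < 1) \<and> (\<Sum>i<J - 1. \<pi> $ i) < 1}"

definition cat_prob :: "nat \<Rightarrow> rvec \<Rightarrow> nat \<Rightarrow> real" where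
  "cat_prob J \<pi> j = (if j = J then 1 - (\<Sum>i<J - 1. \<pi> $ i) else \<pi> $ (j - 1))"

type_synonym ratio = "rvec \<Rightarrow> rvec"

definition adjacent :: "nat \<Rightarrow> ratio" where
  "adjacent J \<pi> = Matrix.vec (J - 1)
     (\<lambda>i. cat_prob J \<pi> (i + 1) / (cat_prob J \<pi> (i + 1) + cat_prob J \<pi> (i + 2)))"

definition cumulative :: "nat \<Rightarrow> ratio" where
  "cumulative J \<pi> = Matrix.vec (J - 1) (\<lambda>i. \<Sum>k = 1..i + 1. cat_prob J \<pi> k)"

definition cdf_support :: "(real \<Rightarrow> real) \<Rightarrow> real set" where
  "cdf_support F = {w. 0 < F w \<and> F w < 1}"

definition symmetric_cdfs :: "(real \<Rightarrow> real) set" where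
  "symmetric_cdfs =
     {F. (\<exists>M. real_distribution M \<and> F = cdf M) \<and> continuous_on UNIV F \<and>
         strict_mono_on (cdf_support F) F \<and> (\<forall>w. F w = 1 - F (- w))}"

type_synonym design = "rvec \<Rightarrow> rmat"

(* Parameters are laid out as (\<alpha>_1, ..., \<alpha>_(J-1), \<delta>_1, ..., \<delta>_(J-1)) with blocks \<delta>_j of length p;
   see complete_design_action. *)
definition complete_design :: "nat \<Rightarrow> nat \<Rightarrow> design" where
  "complete_design J p x = Matrix.mat (J - 1) ((J - 1) * (1 + p))
     (\<lambda>(i, k). if k < J - 1 then (if k = i then 1 else 0)
               else if (k - (J - 1)) div p = i then x $ ((k - (J - 1)) mod p) else 0)"

(* Parameters are laid out as (\<alpha>_1, ..., \<alpha>_(J-1), \<delta>); see proportional_design_action. *)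
definition proportional_design :: "nat \<Rightarrow> nat \<Rightarrow> design" where
  "proportional_design J p x = Matrix.mat (J - 1) (J - 1 + p)
     (\<lambda>(i, k). if k < J - 1 then (if k = i then 1 else 0) else x $ (k - (J - 1)))"

lemma complete_design_action:
  assumes "\<beta> \<in> carrier_vec ((J - 1) * (1 + p))" and "i < J - 1"
  shows "(complete_design J p x *\<^sub>v \<beta>) $ i = \<beta> $ i + (\<Sum>l<p. x $ l * \<beta> $ ((J - 1) + i * p + l))"
proof -
  define n where "n = J - 1"
  have i: "i < n" using assms n_def by simp
  define f where "f k = (if k < n then (if k = i then 1 else 0)
      else if (k - n) div p = i then x $ ((k - n) mod p) else 0) * \<beta> $ k" for k
  have dim: "dim_vec \<beta> = n + n * p"
    using assms(1) n_def by simp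
  have split: "(\<Sum>k<n + m. f k) = (\<Sum>k<n. f k) + (\<Sum>l<m. f (n + l))" for m
    by (induction m) auto
  have "(complete_design J p x *\<^sub>v \<beta>) $ i = (\<Sum>k<n + n * p. f k)"
    using assms(2) dim
    by (auto simp: complete_design_def scalar_prod_def f_def n_def atLeast0LessThan intro!: sum.cong)
  also have "\<dots> = (\<Sum>k<n. f k) + (\<Sum>m<n * p. f (n + m))"
    by (rule split)
  also have "(\<Sum>k<n. f k) = \<beta> $ i"
    using i by (simp add: f_def if_distrib[of "\<lambda>c. c * _"] sum.delta cong: if_cong)
  also have "(\<Sum>m<n * p. f (n + m)) = (\<Sum>m\<in>{i * p..<i * p + p}. f (n + m))"
  proof (rule sum.mono_neutral_right)
    show "{i * p..<i * p + p} \<subseteq> {..<n * p}"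
    proof -
      have "Suc i * p \<le> n * p" using i by (intro mult_le_mono1) simp
      then show ?thesis by auto
    qed
    show "\<forall>m\<in>{..<n * p} - {i * p..<i * p + p}. f (n + m) = 0"
    proof
      fix m assume m: "m \<in> {..<n * p} - {i * p..<i * p + p}"
      then have "p > 0" by (cases p) auto
      then have "m div p \<noteq> i"
        using m by (metis DiffD2 add.commute atLeastLessThan_iff div_mult_mod_eq le_add1
            mod_less_divisor nat_add_left_cancel_less)
      then show "f (n + m) = 0" by (simp add: f_def)
    qed
  qed simp
  also have "\<dots> = (\<Sum>l<p. f (n + (i * p + l)))"
    using sum.shift_bounds_nat_ivl[of "\<lambda>m. f (n + m)" 0 "i * p" p]
    by (simp add: atLeast0LessThan add.commute)
  also have "\<dots> = (\<Sum>l<p. x $ l * \<beta> $ (n + i * p + l))"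
    by (rule sum.cong) (auto simp: f_def add.assoc)
  finally show ?thesis by (simp add: n_def)
qed

lemma proportional_design_action:
  assumes "\<beta> \<in> carrier_vec (J - 1 + p)" and "i < J - 1"
  shows "(proportional_design J p x *\<^sub>v \<beta>) $ i = \<beta> $ i + (\<Sum>l<p. x $ l * \<beta> $ ((J - 1) + l))"
proof -
  define n where "n = J - 1"
  have i: "i < n" using assms n_def by simp
  define f where "f k = (if k < n then (if k = i then 1 else 0) else x $ (k - n)) * \<beta> $ k" for k
  have dim: "dim_vec \<beta> = n + p"
    using assms(1) n_def by simp
  have split: "(\<Sum>k<n + m. f k) = (\<Sum>k<n. f k) + (\<Sum>l<m. f (n + l))" for m
    by (induction m) auto
  have "(proportional_design J p x *\<^sub>v \<beta>) $ i = (\<Sum>k<n + p. f k)"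
    using assms(2) dim
    by (auto simp: proportional_design_def scalar_prod_def f_def n_def atLeast0LessThan intro!: sum.cong)
  also have "\<dots> = (\<Sum>k<n. f k) + (\<Sum>m<p. f (n + m))"
    by (rule split)
  also have "(\<Sum>k<n. f k) = \<beta> $ i"
    using i by (simp add: f_def if_distrib[of "\<lambda>c. c * _"] sum.delta cong: if_cong)
  also have "(\<Sum>m<p. f (n + m)) = (\<Sum>l<p. x $ l * \<beta> $ (n + l))"
    by (rule sum.cong) (auto simp: f_def)
  finally show ?thesis by (simp add: n_def)
qed

type_synonym model = "ratio \<times> (real \<Rightarrow> real) \<times> design"

(* The number q of columns is that of the matrices Z x; the parameter space is meant for nonempty X. *)
definition param_space :: "nat \<Rightarrow> rvec set \<Rightarrow> model \<Rightarrow> rvec set" where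
  "param_space J X = (\<lambda>(r, F, Z).
     {\<beta>. \<forall>x\<in>X. \<beta> \<in> carrier_vec (dim_col (Z x)) \<and>
        (\<forall>i<J - 1. (Z x *\<^sub>v \<beta>) $ i \<in> cdf_support F) \<and>
        map_vec F (Z x *\<^sub>v \<beta>) \<in> r ` prob_simplex J})"

definition permute_probs :: "nat \<Rightarrow> (nat \<Rightarrow> nat) \<Rightarrow> rvec \<Rightarrow> rvec" where
  "permute_probs J \<sigma> \<pi> = Matrix.vec (J - 1) (\<lambda>i. cat_prob J \<pi> (\<sigma> (i + 1)))"

definition model_prob :: "nat \<Rightarrow> model \<Rightarrow> rvec \<Rightarrow> rvec \<Rightarrow> rvec" where
  "model_prob J = (\<lambda>(r, F, Z) x \<beta>.
     THE \<pi>. \<pi> \<in> prob_simplex J \<and> r \<pi> = map_vec F (Z x *\<^sub>v \<beta>))"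

definition permuted_model_prob :: "nat \<Rightarrow> (nat \<Rightarrow> nat) \<Rightarrow> model \<Rightarrow> rvec \<Rightarrow> rvec \<Rightarrow> rvec" where
  "permuted_model_prob J \<sigma> = (\<lambda>(r, F, Z) x \<beta>.
     THE \<pi>. \<pi> \<in> prob_simplex J \<and> r (permute_probs J \<sigma> \<pi>) = map_vec F (Z x *\<^sub>v \<beta>))"

(* A possibly permuted model enters through its parameter space and its map (x, \<beta>) to \<pi>(x; \<beta>). *)
definition equivalent_models ::
  "rvec set \<Rightarrow> rvec set \<times> (rvec \<Rightarrow> rvec \<Rightarrow> rvec) \<Rightarrow> rvec set \<times> (rvec \<Rightarrow> rvec \<Rightarrow> rvec) \<Rightarrow> bool" where
  "equivalent_models X = (\<lambda>(B, P) (B', P').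
     \<exists>h. bij_betw h B B' \<and> (\<forall>x\<in>X. \<forall>\<beta>\<in>B. P x \<beta> = P' x (h \<beta>)))"

definition invariant_under :: "nat \<Rightarrow> rvec set \<Rightarrow> model \<Rightarrow> (nat \<Rightarrow> nat) \<Rightarrow> bool" where
  "invariant_under J X m \<sigma> \<longleftrightarrow>
     equivalent_models X (param_space J X m, model_prob J m)
       (param_space J X m, permuted_model_prob J \<sigma> m)"

definition reverse_perm :: "nat \<Rightarrow> nat \<Rightarrow> nat" where
  "reverse_perm J j = (if j \<in> {1..J} then J - j + 1 else j)"

lemma reverse_perm_permutes: "reverse_perm J permutes {1..J}"
  by (rule bij_imp_permutes)
    (auto simp: reverse_perm_def intro!: bij_betw_byWitness[where f' = "reverse_perm J"])

end

(* Reversing the category order turns the vector r(\<pi>) of ratios into its reverse with every entry u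
   replaced by 1 - u. By symmetry of F, the same happens to the vector of F(\<eta>_j) when \<eta> is replaced
   by its negated reverse, and negating and reversing the parameters (in the proportional case,
   the intercepts are reversed and the common slope is only negated) does this to \<eta>. So the defining
   equations of the two models coincide under a linear involution of the parameters. *)
theory Submission
  imports Defs
begin

section \<open>Category probabilities under reversal\<close>

lemma cat_prob_Suc:
  assumes "i < J - 1"
  shows "cat_prob J \<pi> (Suc i) = \<pi> $ i"
  using assms by (simp add: cat_prob_def)

lemma sum_cat_prob:
  assumes "J \<ge> 1"
  shows "(\<Sum>j = 1..J. cat_prob J \<pi> j) = 1"
proof -
  obtain n where n: "J = Suc n"
    using assms by (cases J) auto
  have "(\<Sum>j = 1..n. cat_prob J \<pi> j) = (\<Sum>i<n. cat_prob J \<pi> (Suc i))"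
    by (simp add: sum.atLeast1_atMost_eq)
  also have "\<dots> = (\<Sum>i<n. \<pi> $ i)"
    by (rule sum.cong) (auto simp: cat_prob_Suc n)
  finally show ?thesis
    by (simp add: n cat_prob_def)
qed

text \<open>Puts the last category on the same footing as the others, so that membership survives a
  permutation of the categories. The upper bound on an entry comes for free: it is at most the sum
  of all the positive entries, which is below 1.\<close>

lemma prob_simplex_iff:
  assumes "J \<ge> 2"
  shows "\<pi> \<in> prob_simplex J \<longleftrightarrow> \<pi> \<in> carrier_vec (J - 1) \<and> (\<forall>j\<in>{1..J}. 0 < cat_prob J \<pi> j)"
proof (intro iffI conjI)
  assume \<pi>: "\<pi> \<in> prob_simplex J"
  then show "\<pi> \<in> carrier_vec (J - 1)"
    by (simp add: prob_simplex_def)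
  show "\<forall>j\<in>{1..J}. 0 < cat_prob J \<pi> j"
    using \<pi> by (auto simp: prob_simplex_def cat_prob_def)
next
  assume *: "\<pi> \<in> carrier_vec (J - 1) \<and> (\<forall>j\<in>{1..J}. 0 < cat_prob J \<pi> j)"
  have pos: "0 < \<pi> $ i" if "i < J - 1" for i
    using * that cat_prob_Suc[OF that, of \<pi>] by (auto dest!: bspec[of _ _ "Suc i"])
  have less1: "(\<Sum>i<J - 1. \<pi> $ i) < 1"
    using * assms by (auto simp: cat_prob_def dest!: bspec[of _ _ J])
  have "\<pi> $ i < 1" if "i < J - 1" for i
    using member_le_sum[of i "{..<J - 1}" "\<lambda>i. \<pi> $ i"] that less1 pos by fastforce
  with * pos less1 show "\<pi> \<in> prob_simplex J"
    by (simp add: prob_simplex_def)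
qed

text \<open>Only j = J has content: there \<open>cat_prob\<close> is a complement rather than a
  stored entry, and the formula rests on the total mass being 1.\<close>

lemma cat_prob_reverse:
  assumes "j \<in> {1..J}"
  shows "cat_prob J (permute_probs J (reverse_perm J) \<pi>) j = cat_prob J \<pi> (J + 1 - j)"
proof (cases "j = J")
  case False
  then obtain i where i: "j = Suc i" "i < J - 1"
    using assms by (cases j) auto
  then have "reverse_perm J (i + 1) = J + 1 - j"
    by (auto simp: reverse_perm_def)
  with i show ?thesis
    by (simp add: cat_prob_Suc permute_probs_def)
next
  case True
  obtain n where n: "J = Suc n"
    using assms by (cases J) auto
  \<comment> \<open>The entry with index i of the reversed vector belongs to category J - i, so the
    stored entries cover all categories except 1.\<close>
  have "(\<Sum>i<n. cat_prob J \<pi> (reverse_perm J (i + 1))) = (\<Sum>j = 2..J. cat_prob J \<pi> j)"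
    by (rule sum.reindex_bij_witness[of _ "\<lambda>j. J - j" "\<lambda>i. J - i"]) (auto simp: n reverse_perm_def Suc_diff_le)
  also have "\<dots> = 1 - cat_prob J \<pi> 1"
    using sum_cat_prob[of J \<pi>] sum.atLeast_Suc_atMost[of 1 J "cat_prob J \<pi>"]
    by (simp add: n numeral_2_eq_2)
  finally show ?thesis
    using True by (simp add: cat_prob_def[of _ "Matrix.vec _ _"] permute_probs_def n)
qed

lemma reverse_in_prob_simplex:
  assumes "J \<ge> 2" and "\<pi> \<in> prob_simplex J"
  shows "permute_probs J (reverse_perm J) \<pi> \<in> prob_simplex J"
  unfolding prob_simplex_iff[OF assms(1)]
proof (intro conjI ballI)
  show "permute_probs J (reverse_perm J) \<pi> \<in> carrier_vec (J - 1)"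
    by (simp add: permute_probs_def)
  fix j assume j: "j \<in> {1..J}"
  then have "J + 1 - j \<in> {1..J}"
    by auto
  with assms prob_simplex_iff[of J \<pi>] have "0 < cat_prob J \<pi> (J + 1 - j)"
    by blast
  then show "0 < cat_prob J (permute_probs J (reverse_perm J) \<pi>) j"
    by (simp only: cat_prob_reverse[OF j])
qed

section \<open>Reversal of predictors and of ratios\<close>

definition reverse_compl :: "rvec \<Rightarrow> rvec" where
  "reverse_compl v = Matrix.vec (dim_vec v) (\<lambda>i. 1 - v $ (dim_vec v - 1 - i))"

definition reverse_neg :: "rvec \<Rightarrow> rvec" where
  "reverse_neg v = Matrix.vec (dim_vec v) (\<lambda>i. - v $ (dim_vec v - 1 - i))"

lemma reverse_compl_involutive: "reverse_compl (reverse_compl v) = v"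
  by (rule eq_vecI) (auto simp: reverse_compl_def)

text \<open>Symmetry of \<open>F\<close> turns a negated argument into a complemented value, and
  reversal commutes with applying \<open>F\<close> entrywise.\<close>

lemma map_vec_reverse_neg:
  assumes "\<And>w. F w = 1 - F (- w)"
  shows "map_vec F (reverse_neg v) = reverse_compl (map_vec F v)"
proof (rule eq_vecI)
  fix i assume "i < dim_vec (reverse_compl (map_vec F v))"
  then show "map_vec F (reverse_neg v) $ i = reverse_compl (map_vec F v) $ i"
    using assms[of "- v $ (dim_vec v - 1 - i)"] by (simp add: reverse_neg_def reverse_compl_def)
qed (simp add: reverse_neg_def reverse_compl_def)

text \<open>Reversal swaps the members of each adjacent pair, so a/(a+b) becomes b/(a+b) = 1 -
  a/(a+b). Membership in the simplex keeps the denominator away from 0.\<close>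

lemma adjacent_reverse:
  assumes "J \<ge> 2" and "\<pi> \<in> prob_simplex J"
  shows "adjacent J (permute_probs J (reverse_perm J) \<pi>) = reverse_compl (adjacent J \<pi>)"
proof (rule eq_vecI)
  let ?p = "cat_prob J \<pi>"
  fix i assume "i < dim_vec (reverse_compl (adjacent J \<pi>))"
  then have i: "i < J - 1"
    by (simp add: reverse_compl_def adjacent_def)
  \<comment> \<open>Positions i + 1 and i + 2 of the reversed order hold the categories k + 1 and k.
    The equations below bring every truncated difference into terms of k.\<close>
  define k where "k = J - 1 - i"
  have k: "J - i = Suc k" "J + 1 - (i + 1) = Suc k" "J + 1 - (i + 2) = k" "k \<ge> 1" "Suc k \<le> J"
    "J - 1 - 1 - i + 1 = k" "J - 1 - 1 - i + 2 = Suc k"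
    using i by (auto simp: k_def)
  have pos: "0 < ?p k" "0 < ?p (Suc k)"
    using assms(2) k unfolding prob_simplex_iff[OF assms(1)] by auto
  have "adjacent J (permute_probs J (reverse_perm J) \<pi>) $ i = ?p (Suc k) / (?p (Suc k) + ?p k)"
    using i k by (simp add: adjacent_def cat_prob_reverse del: One_nat_def)
  also have "\<dots> = 1 - ?p k / (?p k + ?p (Suc k))"
    using pos by (simp add: field_simps)
  also have "\<dots> = reverse_compl (adjacent J \<pi>) $ i"
  proof -
    have "reverse_compl (adjacent J \<pi>) $ i =
      1 - ?p (J - 1 - 1 - i + 1) / (?p (J - 1 - 1 - i + 1) + ?p (J - 1 - 1 - i + 2))"
      using i by (simp add: reverse_compl_def adjacent_def)
    then show ?thesis
      unfolding k by simp
  qed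
  finally show "adjacent J (permute_probs J (reverse_perm J) \<pi>) $ i = reverse_compl (adjacent J \<pi>) $ i" .
qed (simp add: reverse_compl_def adjacent_def)

text \<open>The first i + 1 categories in reversed order are the last i + 1 in the original order,
  and their mass is 1 minus that of the first J - 1 - i.\<close>

lemma cumulative_reverse:
  "cumulative J (permute_probs J (reverse_perm J) \<pi>) = reverse_compl (cumulative J \<pi>)"
proof (rule eq_vecI)
  let ?p = "cat_prob J \<pi>"
  fix i assume "i < dim_vec (reverse_compl (cumulative J \<pi>))"
  then have i: "i < J - 1"
    by (simp add: reverse_compl_def cumulative_def)
  have "cumulative J (permute_probs J (reverse_perm J) \<pi>) $ i = (\<Sum>k = 1..i + 1. ?p (J + 1 - k))"
    using i by (auto simp: cumulative_def cat_prob_reverse intro!: sum.cong)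
  also have "\<dots> = (\<Sum>k = J - i..J. ?p k)"
    using i by (intro sum.reindex_bij_witness[of _ "\<lambda>k. J + 1 - k" "\<lambda>k. J + 1 - k"]) auto
  also have "\<dots> = 1 - (\<Sum>k = 1..J - 1 - i. ?p k)"
  proof -
    have "{1..J} = {1..J - 1 - i} \<union> {J - i..J}"
      using i by auto
    then have "(\<Sum>k = 1..J. ?p k) = (\<Sum>k = 1..J - 1 - i. ?p k) + (\<Sum>k = J - i..J. ?p k)"
      using i by (simp only:) (rule sum.union_disjoint; auto)
    then show ?thesis
      using sum_cat_prob[of J \<pi>] i by (simp add: algebra_simps)
  qed
  also have "\<dots> = reverse_compl (cumulative J \<pi>) $ i"
  proof -
    \<comment> \<open>Entry m of \<open>cumulative\<close> sums m + 1 categories, hence the extra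
      shift by one.\<close>
    define m where "m = J - 1 - 1 - i"
    have m: "m < J - 1" "J - 1 - i = m + 1"
      using i by (auto simp: m_def)
    have "reverse_compl (cumulative J \<pi>) $ i = 1 - cumulative J \<pi> $ m"
      using i by (simp add: reverse_compl_def cumulative_def m_def)
    with m show ?thesis
      by (simp add: cumulative_def del: sum.cl_ivl_Suc)
  qed
  finally show "cumulative J (permute_probs J (reverse_perm J) \<pi>) $ i
    = reverse_compl (cumulative J \<pi>) $ i" .
qed (simp add: reverse_compl_def cumulative_def)

section \<open>Invariance from an involution of the parameters\<close>

text \<open>Separates design from ratio: \<open>h\<close> reverses and negates the predictors,
  \<open>r\<close> turns category reversal into reversal and complement, and symmetry of
  \<open>F\<close> matches the two. Since \<open>h\<close> is its own inverse, mapping the parameter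
  space into itself makes it a bijection.\<close>

lemma invariant_under_reverse:
  assumes J: "J \<ge> 2" and X: "X \<noteq> {}"
    and F: "\<And>w. F w = 1 - F (- w)"
    and dim: "\<And>x. x \<in> X \<Longrightarrow> Z x \<in> carrier_mat (J - 1) q"
    and h_carrier: "\<And>\<beta>. \<beta> \<in> carrier_vec q \<Longrightarrow> h \<beta> \<in> carrier_vec q"
    and h_inv: "\<And>\<beta>. \<beta> \<in> carrier_vec q \<Longrightarrow> h (h \<beta>) = \<beta>"
    and h: "\<And>x \<beta>. x \<in> X \<Longrightarrow> \<beta> \<in> carrier_vec q \<Longrightarrow> Z x *\<^sub>v h \<beta> = reverse_neg (Z x *\<^sub>v \<beta>)"
    and r: "\<And>\<pi>. \<pi> \<in> prob_simplex J \<Longrightarrow>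
      r (permute_probs J (reverse_perm J) \<pi>) = reverse_compl (r \<pi>)"
  shows "invariant_under J X (r, F, Z) (reverse_perm J)"
proof -
  let ?B = "param_space J X (r, F, Z)"
  \<comment> \<open>\<open>param_space\<close> fixes the dimension of a parameter only through some
    x in X, so X must have an element.\<close>
  have B_carrier: "\<beta> \<in> carrier_vec q" if "\<beta> \<in> ?B" for \<beta>
    using that X dim by (fastforce simp: param_space_def)
  have supp: "- w \<in> cdf_support F" if "w \<in> cdf_support F" for w
    using that F[of w] by (simp add: cdf_support_def)
  have Fh: "map_vec F (Z x *\<^sub>v h \<beta>) = reverse_compl (map_vec F (Z x *\<^sub>v \<beta>))"
    if "x \<in> X" "\<beta> \<in> carrier_vec q" for x \<beta>
    using h[OF that] map_vec_reverse_neg[of F, OF F] by simp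
  have hB: "h \<beta> \<in> ?B" if \<beta>: "\<beta> \<in> ?B" for \<beta>
  proof -
    have "h \<beta> \<in> carrier_vec (dim_col (Z x)) \<and>
        (\<forall>i<J - 1. (Z x *\<^sub>v h \<beta>) $ i \<in> cdf_support F) \<and>
        map_vec F (Z x *\<^sub>v h \<beta>) \<in> r ` prob_simplex J" if x: "x \<in> X" for x
    proof (intro conjI allI impI)
      show "h \<beta> \<in> carrier_vec (dim_col (Z x))"
        using h_carrier[OF B_carrier[OF \<beta>]] dim[OF x] by simp
      show "(Z x *\<^sub>v h \<beta>) $ i \<in> cdf_support F" if "i < J - 1" for i
      proof -
        have "(Z x *\<^sub>v \<beta>) $ (J - 1 - 1 - i) \<in> cdf_support F"
          using \<beta> x that by (auto simp: param_space_def)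
        then show ?thesis
          unfolding h[OF x B_carrier[OF \<beta>]]
          using that dim[OF x] supp by (simp add: reverse_neg_def del: index_mult_mat_vec)
      qed
      \<comment> \<open>If \<pi> realizes the ratios at \<beta>, its reversal realizes those at
        \<open>h\<close> \<beta>.\<close>
      obtain \<pi> where \<pi>: "\<pi> \<in> prob_simplex J" "map_vec F (Z x *\<^sub>v \<beta>) = r \<pi>"
        using \<beta> x by (auto simp: param_space_def)
      then have "map_vec F (Z x *\<^sub>v h \<beta>) = r (permute_probs J (reverse_perm J) \<pi>)"
        using Fh[OF x B_carrier[OF \<beta>]] r by simp
      then show "map_vec F (Z x *\<^sub>v h \<beta>) \<in> r ` prob_simplex J"
        using reverse_in_prob_simplex[OF J \<pi>(1)] by blast
    qed
    then show ?thesis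
      by (simp add: param_space_def)
  qed
  have "bij_betw h ?B ?B"
    by (rule bij_betw_byWitness[where f' = h]) (auto simp: h_inv B_carrier hB)
  moreover have "model_prob J (r, F, Z) x \<beta> =
      permuted_model_prob J (reverse_perm J) (r, F, Z) x (h \<beta>)"
    if "x \<in> X" "\<beta> \<in> ?B" for x \<beta>
  proof -
    \<comment> \<open>The second equation is the first with \<open>reverse_compl\<close> applied to
      both sides, and an involution is injective. The two definite descriptions then have the same
      predicate.\<close>
    have "r \<pi> = map_vec F (Z x *\<^sub>v \<beta>) \<longleftrightarrow>
        r (permute_probs J (reverse_perm J) \<pi>) = map_vec F (Z x *\<^sub>v h \<beta>)"
      if "\<pi> \<in> prob_simplex J" for \<pi>
      unfolding r[OF that] Fh[OF \<open>x \<in> X\<close> B_carrier[OF \<open>\<beta> \<in> ?B\<close>]]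
      by (metis reverse_compl_involutive)
    then show ?thesis
      unfolding model_prob_def permuted_model_prob_def
      by (auto intro!: arg_cong[where f = The])
  qed
  ultimately show ?thesis
    unfolding invariant_under_def equivalent_models_def by auto
qed

section \<open>The complete design\<close>

text \<open>Slope blocks change places as wholes: \<open>div p\<close> finds the block and
  \<open>mod p\<close> the coordinate in it, which keeps its place because it must stay paired with
  the same coordinate of x.\<close>

definition complete_reversal :: "nat \<Rightarrow> nat \<Rightarrow> rvec \<Rightarrow> rvec" where
  "complete_reversal J p \<beta> = Matrix.vec ((J - 1) * (1 + p))
     (\<lambda>k. if k < J - 1 then - \<beta> $ (J - 1 - 1 - k)
          else - \<beta> $ ((J - 1) + (J - 1 - 1 - (k - (J - 1)) div p) * p + (k - (J - 1)) mod p))"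

lemma block_index_less:
  fixes i l n p :: nat
  assumes "i < n" and "l < p"
  shows "n + i * p + l < n * (1 + p)"
proof -
  have "Suc i * p \<le> n * p"
    using assms by (intro mult_le_mono1) simp
  then show ?thesis
    using assms by simp
qed

lemma complete_reversal_intercept:
  assumes "i < J - 1"
  shows "complete_reversal J p \<beta> $ i = - \<beta> $ (J - 1 - 1 - i)"
proof -
  have "i < (J - 1) * (1 + p)"
    using assms by (simp add: trans_less_add1)
  then show ?thesis
    using assms by (simp add: complete_reversal_def)
qed

lemma complete_reversal_slope:
  assumes "i < J - 1" and "l < p"
  shows "complete_reversal J p \<beta> $ ((J - 1) + i * p + l) = - \<beta> $ ((J - 1) + (J - 1 - 1 - i) * p + l)"
  using block_index_less[OF assms] assms by (simp add: complete_reversal_def add.assoc)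

lemma complete_reversal_involutive:
  assumes "\<beta> \<in> carrier_vec ((J - 1) * (1 + p))"
  shows "complete_reversal J p (complete_reversal J p \<beta>) = \<beta>"
proof (rule eq_vecI)
  show "dim_vec (complete_reversal J p (complete_reversal J p \<beta>)) = dim_vec \<beta>"
    using assms by (simp add: complete_reversal_def)
  fix k assume "k < dim_vec \<beta>"
  then have k: "k < (J - 1) * (1 + p)"
    using assms by simp
  show "complete_reversal J p (complete_reversal J p \<beta>) $ k = \<beta> $ k"
  proof (cases "k < J - 1")
    case True
    then have "J - 1 - 1 - k < J - 1" "J - 1 - 1 - (J - 1 - 1 - k) = k"
      by auto
    with True show ?thesis
      by (simp add: complete_reversal_intercept del: diff_diff_left)
  next
    case False
    \<comment> \<open>Decoding k as coordinate l of block i reduces the claim to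
      \<open>complete_reversal_slope\<close>, used twice. The mere existence of a slope index forces
      p > 0, which bounds l.\<close>
    define i l where "i = (k - (J - 1)) div p" and "l = (k - (J - 1)) mod p"
    have m: "k - (J - 1) < (J - 1) * p"
      using k False by simp
    then have "p > 0"
      by (cases p) auto
    then have il: "i < J - 1" "l < p"
      using m by (auto simp: i_def l_def less_mult_imp_div_less)
    have "k = (J - 1) + i * p + l"
      using False by (simp add: i_def l_def)
    moreover have "J - 1 - 1 - i < J - 1" "J - 1 - 1 - (J - 1 - 1 - i) = i"
      using il by auto
    ultimately show ?thesis
      using il by (simp only: complete_reversal_slope minus_minus)
  qed
qed

text \<open>Row i of the product sees only intercept i and slope block i. Both are replaced by the
  negatives of those for the mirrored row J - 2 - i.\<close>

lemma complete_design_reversal: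
  assumes "\<beta> \<in> carrier_vec ((J - 1) * (1 + p))"
  shows "complete_design J p x *\<^sub>v complete_reversal J p \<beta> =
    reverse_neg (complete_design J p x *\<^sub>v \<beta>)"
proof (rule eq_vecI)
  have dim: "dim_vec (complete_design J p x *\<^sub>v \<beta>) = J - 1"
    by (simp add: complete_design_def)
  fix i assume "i < dim_vec (reverse_neg (complete_design J p x *\<^sub>v \<beta>))"
  then have i: "i < J - 1" "J - 1 - 1 - i < J - 1"
    using dim by (auto simp: reverse_neg_def)
  have "complete_reversal J p \<beta> \<in> carrier_vec ((J - 1) * (1 + p))"
    by (simp add: complete_reversal_def)
  from complete_design_action[OF this i(1), of x] complete_design_action[OF assms i(2), of x]
  show "(complete_design J p x *\<^sub>v complete_reversal J p \<beta>) $ i =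
      reverse_neg (complete_design J p x *\<^sub>v \<beta>) $ i"
    using i dim complete_reversal_intercept[OF i(1)] complete_reversal_slope[OF i(1)]
    by (simp add: reverse_neg_def sum_negf del: index_mult_mat_vec dim_mult_mat_vec)
qed (simp add: reverse_neg_def complete_design_def)

section \<open>The proportional design\<close>

definition proportional_reversal :: "nat \<Rightarrow> nat \<Rightarrow> rvec \<Rightarrow> rvec" where
  "proportional_reversal J p \<beta> = Matrix.vec (J - 1 + p)
     (\<lambda>k. if k < J - 1 then - \<beta> $ (J - 1 - 1 - k) else - \<beta> $ k)"

lemma proportional_reversal_involutive:
  assumes "\<beta> \<in> carrier_vec (J - 1 + p)"
  shows "proportional_reversal J p (proportional_reversal J p \<beta>) = \<beta>"
proof (rule eq_vecI)
  fix k assume "k < dim_vec \<beta>"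
  moreover have "J - 1 - 1 - k < J - 1" "J - 1 - 1 - (J - 1 - 1 - k) = k" if "k < J - 1"
    using that by auto
  ultimately show "proportional_reversal J p (proportional_reversal J p \<beta>) $ k = \<beta> $ k"
    using assms by (auto simp: proportional_reversal_def simp del: diff_diff_left)
qed (use assms in \<open>simp add: proportional_reversal_def\<close>)

text \<open>The slope contributes the same term to every row, so reversing the rows leaves that term
  alone and only its sign has to change.\<close>

lemma proportional_design_reversal:
  assumes "\<beta> \<in> carrier_vec (J - 1 + p)"
  shows "proportional_design J p x *\<^sub>v proportional_reversal J p \<beta> =
    reverse_neg (proportional_design J p x *\<^sub>v \<beta>)"
proof (rule eq_vecI)
  have dim: "dim_vec (proportional_design J p x *\<^sub>v \<beta>) = J - 1"
    by (simp add: proportional_design_def)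
  fix i assume "i < dim_vec (reverse_neg (proportional_design J p x *\<^sub>v \<beta>))"
  then have i: "i < J - 1" "J - 1 - 1 - i < J - 1"
    using dim by (auto simp: reverse_neg_def)
  have intercept: "proportional_reversal J p \<beta> $ i = - \<beta> $ (J - 1 - 1 - i)"
    using i by (simp add: proportional_reversal_def)
  have slope: "proportional_reversal J p \<beta> $ ((J - 1) + l) = - \<beta> $ ((J - 1) + l)" if "l < p" for l
    using that by (simp add: proportional_reversal_def)
  have "proportional_reversal J p \<beta> \<in> carrier_vec (J - 1 + p)"
    by (simp add: proportional_reversal_def)
  from proportional_design_action[OF this i(1), of x] proportional_design_action[OF assms i(2), of x]
  show "(proportional_design J p x *\<^sub>v proportional_reversal J p \<beta>) $ i =
      reverse_neg (proportional_design J p x *\<^sub>v \<beta>) $ i"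
    using i dim intercept slope
    by (simp add: reverse_neg_def sum_negf del: index_mult_mat_vec dim_mult_mat_vec)
qed (simp add: reverse_neg_def proportional_design_def)

theorem corollary8:
  fixes J p :: nat and X :: "rvec set" and F :: "real \<Rightarrow> real"
  assumes "J \<ge> 3" and "p \<ge> 1"
    and "X \<subseteq> carrier_vec p" and "X \<noteq> {}"
    and "F \<in> symmetric_cdfs"
  shows "invariant_under J X (adjacent J, F, complete_design J p) (reverse_perm J) \<and>
    invariant_under J X (adjacent J, F, proportional_design J p) (reverse_perm J) \<and>
    invariant_under J X (cumulative J, F, complete_design J p) (reverse_perm J) \<and>
    invariant_under J X (cumulative J, F, proportional_design J p) (reverse_perm J)"
proof -
  have J: "J \<ge> 2"
    using assms(1) by simp
  have F: "F w = 1 - F (- w)" for w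
    using assms(5) unfolding symmetric_cdfs_def by blast
  \<comment> \<open>Stated for any ratio with the reversal property, so that each design is treated
    once and serves both ratios.\<close>
  have complete: "invariant_under J X (r, F, complete_design J p) (reverse_perm J)"
    if "\<And>\<pi>. \<pi> \<in> prob_simplex J \<Longrightarrow>
      r (permute_probs J (reverse_perm J) \<pi>) = reverse_compl (r \<pi>)" for r
  proof (rule invariant_under_reverse[where F = F and h = "complete_reversal J p", OF J assms(4) F])
    show "complete_design J p x \<in> carrier_mat (J - 1) ((J - 1) * (1 + p))" for x
      by (simp add: complete_design_def)
    show "complete_reversal J p \<beta> \<in> carrier_vec ((J - 1) * (1 + p))" for \<beta>
      by (simp add: complete_reversal_def)
  qed (rule complete_reversal_involutive complete_design_reversal that; assumption)+
  have proportional: "invariant_under J X (r, F, proportional_design J p) (reverse_perm J)"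
    if "\<And>\<pi>. \<pi> \<in> prob_simplex J \<Longrightarrow>
      r (permute_probs J (reverse_perm J) \<pi>) = reverse_compl (r \<pi>)" for r
  proof (rule invariant_under_reverse[where F = F and h = "proportional_reversal J p", OF J assms(4) F])
    show "proportional_design J p x \<in> carrier_mat (J - 1) (J - 1 + p)" for x
      by (simp add: proportional_design_def)
    show "proportional_reversal J p \<beta> \<in> carrier_vec (J - 1 + p)" for \<beta>
      by (simp add: proportional_reversal_def)
  qed (rule proportional_reversal_involutive proportional_design_reversal that; assumption)+
  show ?thesis
    by (intro conjI complete proportional adjacent_reverse[OF J] cumulative_reverse)
qed

end
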